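(* For every finite state space $\Omega$, every prior $\mathcal{D}$ on $\Omega$, every pair of initial knowledge partitions for Alice and Bob, and every $f:\Omega\to[0,1]$, the standard protocol causes Alice and Bob to $(\varepsilon,\delta)$-agree after at most $1/(\delta\varepsilon^2)$ messages, for all $\varepsilon,\delta>0$.
   Context: $\Omega$ is a finite set of states and $\mathcal{D}$ is a common prior on $\Omega$ with full support. Alice's and Bob's initial knowledge are partitions of $\Omega$; $\Omega_{i,0}(\omega)$ denotes agent $i$'s block containing the true state $\omega$. Standard protocol: the agents alternate messages, Alice first, and at each turn the sender $i$ announces her current expectation $E_{i,t-1}(\omega)$ of $f$, a real number. After the $t$-th message the receiver $j$ updates $$\Omega_{j,t}(\omega)=\Omega_{j,t-1}(\omega)\cap\{\omega':E_{i,t-1}(\omega')=E_{i,t-1}(\omega)\},$$ and the sender's set is unchanged. Here $E_{i,t}(\omega)=\mathbb{E}_{\omega'\sim\mathcal{D}}[f(\omega')\mid\omega'\in\Omega_{i,t}(\omega)]$. After the $t$-th message the agents $(\varepsilon,\delta)$-agree if $\Pr_{\omega\sim\mathcal{D}}[|E_{A,t}(\omega)-E_{B,t}(\omega)|>\varepsilon]\le\delta$; the claim is that this holds at some $t\le 1/(\delta\varepsilon^2)$. *)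

theory Defs
  imports "HOL-Probability.Probability"
begin

datatype agent = Alice | Bob

text \<open>Sender of the \<open>t\<close>-th message; messages are numbered from 1, and Alice sends the first one.\<close>

definition sender :: "nat \<Rightarrow> agent" where
  "sender t = (if odd t then Alice else Bob)"

definition block :: "'w set set \<Rightarrow> 'w \<Rightarrow> 'w set" where
  "block P \<omega> = (THE X. X \<in> P \<and> \<omega> \<in> X)"

definition cond_expect :: "'w pmf \<Rightarrow> ('w \<Rightarrow> real) \<Rightarrow> 'w set \<Rightarrow> real" where
  "cond_expect D f S = measure_pmf.expectation (cond_pmf D S) f"

text \<open>\<open>knowledge D f P t i \<omega>\<close> is the set of states that agent \<open>i\<close> considers possible after
  the \<open>t\<close>-th message of the standard protocol when the true state is \<open>\<omega>\<close>; \<open>P i\<close> is the initial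
  knowledge partition of agent \<open>i\<close>.\<close>

primrec knowledge ::
  "'w pmf \<Rightarrow> ('w \<Rightarrow> real) \<Rightarrow> (agent \<Rightarrow> 'w set set) \<Rightarrow> nat \<Rightarrow> agent \<Rightarrow> 'w \<Rightarrow> 'w set" where
  "knowledge D f P 0 = (\<lambda>i \<omega>. block (P i) \<omega>)"
| "knowledge D f P (Suc t) = (\<lambda>j \<omega>.
     if j = sender (Suc t) then knowledge D f P t j \<omega>
     else knowledge D f P t j \<omega> \<inter>
       {\<omega>'. cond_expect D f (knowledge D f P t (sender (Suc t)) \<omega>') =
             cond_expect D f (knowledge D f P t (sender (Suc t)) \<omega>)})"

definition expect ::
  "'w pmf \<Rightarrow> ('w \<Rightarrow> real) \<Rightarrow> (agent \<Rightarrow> 'w set set) \<Rightarrow> agent \<Rightarrow> nat \<Rightarrow> 'w \<Rightarrow> real" where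
  "expect D f P i t \<omega> = cond_expect D f (knowledge D f P t i \<omega>)"

definition agree_after ::
  "'w pmf \<Rightarrow> ('w \<Rightarrow> real) \<Rightarrow> (agent \<Rightarrow> 'w set set) \<Rightarrow> real \<Rightarrow> real \<Rightarrow> nat \<Rightarrow> bool" where
  "agree_after D f P \<epsilon> \<delta> t \<longleftrightarrow>
     measure_pmf.prob D {\<omega>. \<bar>expect D f P Alice t \<omega> - expect D f P Bob t \<omega>\<bar> > \<epsilon>} \<le> \<delta>"

end

theory Submission
  imports Defs
begin

text \<open>
  After a message the receiver's partition refines the level sets of the announced expectation.
  Hence the sender's expectation \<open>F\<close> is the orthogonal projection of the receiver's new expectation
  \<open>G\<close>, and \<open>\<parallel>G - c\<parallel>\<^sup>2 = \<parallel>F - c\<parallel>\<^sup>2 + \<parallel>G - F\<parallel>\<^sup>2\<close> for every constant \<open>c\<close>. If the agents still disagree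
  after that message, then \<open>\<parallel>G - F\<parallel>\<^sup>2 > \<delta>\<epsilon>\<^sup>2\<close> by Markov's inequality. As the receiver is the next
  sender, the deviation of the latest receiver's expectation from \<open>c\<close> grows by more than \<open>\<delta>\<epsilon>\<^sup>2\<close> per
  message. With \<open>c = 1/2\<close> it never exceeds \<open>1/4\<close>, which leaves room for the rounding of
  \<open>1 / (\<delta>\<epsilon>\<^sup>2)\<close> to an integer.
\<close>

section \<open>Knowledge as cells of partitions\<close>

text \<open>The cell map of a partition of \<open>\<Omega>\<close>, encoded pointwise because
  \<open>knowledge\<close> already has the form of a map from states to sets. Values outside
  \<open>\<Omega>\<close> are left unconstrained.\<close>

definition information_map :: "'w set \<Rightarrow> ('w \<Rightarrow> 'w set) \<Rightarrow> bool" where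
  "information_map \<Omega> K \<longleftrightarrow>
     (\<forall>\<omega>\<in>\<Omega>. \<omega> \<in> K \<omega> \<and> K \<omega> \<subseteq> \<Omega> \<and> (\<forall>\<omega>'\<in>K \<omega>. K \<omega>' = K \<omega>))"

lemma information_mapD:
  assumes "information_map \<Omega> K" "\<omega> \<in> \<Omega>"
  shows "\<omega> \<in> K \<omega>" "K \<omega> \<subseteq> \<Omega>" "\<omega>' \<in> K \<omega> \<Longrightarrow> K \<omega>' = K \<omega>"
  using assms unfolding information_map_def by blast+

lemma block_eq:
  assumes "partition_on \<Omega> Q" "X \<in> Q" "\<omega> \<in> X"
  shows "block Q \<omega> = X"
  unfolding block_def
proof (rule the_equality)
  fix Y assume "Y \<in> Q \<and> \<omega> \<in> Y"
  then show "Y = X"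
    using disjointD[OF partition_onD2[OF assms(1)], of Y X] assms(2,3) by blast
qed (use assms in simp)

lemma information_map_block:
  assumes "partition_on \<Omega> Q"
  shows "information_map \<Omega> (block Q)"
  unfolding information_map_def
proof
  fix \<omega> assume "\<omega> \<in> \<Omega>"
  then obtain X where X: "X \<in> Q" "\<omega> \<in> X" "X \<subseteq> \<Omega>"
    using partition_onD1[OF assms] by auto
  then show "\<omega> \<in> block Q \<omega> \<and> block Q \<omega> \<subseteq> \<Omega> \<and> (\<forall>\<omega>'\<in>block Q \<omega>. block Q \<omega>' = block Q \<omega>)"
    using block_eq[OF assms X(1)] by auto
qed

text \<open>The receiver intersects a cell with a level set of a function of the state. Two states
  in the same new cell share both the old cell and the announced value, so they define the same
  intersection.\<close>

lemma information_map_knowledge: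
  assumes "\<And>i. partition_on \<Omega> (P i)"
  shows "information_map \<Omega> (knowledge D f P t i)"
proof (induction t arbitrary: i)
  case 0
  then show ?case using information_map_block[OF assms[of i]] by simp
next
  case (Suc t)
  note IH = information_mapD[OF Suc.IH[of i]]
  show ?case
    unfolding information_map_def
  proof
    fix \<omega> assume "\<omega> \<in> \<Omega>"
    note IH = IH[OF this]
    have "\<omega> \<in> knowledge D f P (Suc t) i \<omega>"
      using IH(1) by auto
    moreover have "knowledge D f P (Suc t) i \<omega> \<subseteq> \<Omega>"
      using IH(2) by auto
    moreover have "knowledge D f P (Suc t) i \<omega>' = knowledge D f P (Suc t) i \<omega>"
      if "\<omega>' \<in> knowledge D f P (Suc t) i \<omega>" for \<omega>'
    proof -
      have "\<omega>' \<in> knowledge D f P t i \<omega>"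
        using that by (simp split: if_splits)
      from IH(3)[OF this] show ?thesis using that by (simp split: if_splits)
    qed
    ultimately show "\<omega> \<in> knowledge D f P (Suc t) i \<omega> \<and> knowledge D f P (Suc t) i \<omega> \<subseteq> \<Omega> \<and>
        (\<forall>\<omega>'\<in>knowledge D f P (Suc t) i \<omega>. knowledge D f P (Suc t) i \<omega>' = knowledge D f P (Suc t) i \<omega>)"
      by blast
  qed
qed

section \<open>Conditional expectation as an orthogonal projection\<close>

lemma cond_expect_eq_sum:
  assumes "finite S" "S \<subseteq> set_pmf D" "S \<noteq> {}"
  shows "cond_expect D f S = (\<Sum>x\<in>S. pmf D x * f x) / (\<Sum>x\<in>S. pmf D x)"
proof -
  \<comment> \<open>\<open>pmf_cond\<close> describes \<open>cond_pmf\<close> only on sets that meet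
    the support.\<close>
  have ne: "set_pmf D \<inter> S \<noteq> {}" using assms by auto
  have "cond_expect D f S = (\<Sum>x\<in>S. f x * pmf (cond_pmf D S) x)"
    unfolding cond_expect_def
    by (rule integral_measure_pmf_real) (use assms ne in \<open>auto\<close>)
  also have "\<dots> = (\<Sum>x\<in>S. pmf D x * f x / measure_pmf.prob D S)"
    by (intro sum.cong) (auto simp: pmf_cond[OF ne])
  also have "\<dots> = (\<Sum>x\<in>S. pmf D x * f x) / measure_pmf.prob D S"
    by (simp add: sum_divide_distrib)
  finally show ?thesis using assms by (simp add: measure_measure_pmf_finite)
qed

lemma cond_expect_mem_Icc:
  assumes "finite S" "S \<subseteq> set_pmf D" "S \<noteq> {}" "\<And>x. x \<in> S \<Longrightarrow> f x \<in> {a..b}"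
  shows "cond_expect D f S \<in> {a..b}"
proof -
  have pos: "0 < (\<Sum>x\<in>S. pmf D x)"
    using assms by (intro sum_pos) (auto simp: pmf_positive_iff)
  have "a * (\<Sum>x\<in>S. pmf D x) \<le> (\<Sum>x\<in>S. pmf D x * f x)"
    "(\<Sum>x\<in>S. pmf D x * f x) \<le> b * (\<Sum>x\<in>S. pmf D x)"
    using assms(4)
    by (auto simp: sum_distrib_left mult.commute intro!: sum_mono mult_right_mono)
  then show ?thesis
    using pos cond_expect_eq_sum[OF assms(1-3), of f] by (simp add: pos_le_divide_eq pos_divide_le_eq)
qed

text \<open>The defining property of conditional expectation, tested against a function
  \<open>h\<close> that is constant on cells. Expanding the average gives a double sum over pairs of
  states in a common cell; after swapping the order, the inner sum of prior weights cancels the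
  denominator.\<close>

lemma sum_cond_expect_mult:
  assumes fin: "finite \<Omega>" and D: "set_pmf D = \<Omega>" and K: "information_map \<Omega> K"
    and h: "\<And>\<omega> \<omega>'. \<omega> \<in> \<Omega> \<Longrightarrow> \<omega>' \<in> K \<omega> \<Longrightarrow> h \<omega>' = h \<omega>"
  shows "(\<Sum>\<omega>\<in>\<Omega>. pmf D \<omega> * (cond_expect D f (K \<omega>) * h \<omega>)) = (\<Sum>\<omega>\<in>\<Omega>. pmf D \<omega> * (f \<omega> * h \<omega>))"
proof -
  define m where "m \<omega> = (\<Sum>x\<in>K \<omega>. pmf D x)" for \<omega>
  note KD = information_mapD[OF K]
  have finK: "finite (K \<omega>)" if "\<omega> \<in> \<Omega>" for \<omega>
    using KD(2)[OF that] fin finite_subset by blast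
  have mpos: "m \<omega> > 0" if "\<omega> \<in> \<Omega>" for \<omega>
    unfolding m_def using KD(1,2)[OF that] finK[OF that] D
    by (intro sum_pos) (auto simp: pmf_positive_iff)
  have sym: "\<omega> \<in> K \<omega>' \<longleftrightarrow> \<omega>' \<in> K \<omega>" if "\<omega> \<in> \<Omega>" "\<omega>' \<in> \<Omega>" for \<omega> \<omega>'
    using that KD by metis
  \<comment> \<open>Writing a sum over a cell as a sum over all of \<open>\<Omega>\<close> makes the
    index sets independent, as \<open>sum.swap\<close> requires.\<close>
  have restr: "(\<Sum>x\<in>\<Omega>. if x \<in> K \<omega> then g x else 0) = sum g (K \<omega>)" if "\<omega> \<in> \<Omega>" for \<omega> and g :: "'a \<Rightarrow> real"
    using KD(2)[OF that] fin by (simp add: sum.If_cases Int_absorb1)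
  have "(\<Sum>\<omega>\<in>\<Omega>. pmf D \<omega> * (cond_expect D f (K \<omega>) * h \<omega>))
      = (\<Sum>\<omega>\<in>\<Omega>. \<Sum>x\<in>K \<omega>. pmf D \<omega> * (pmf D x * f x * h \<omega> / m \<omega>))"
  proof (rule sum.cong[OF refl])
    fix \<omega> assume w: "\<omega> \<in> \<Omega>"
    have "cond_expect D f (K \<omega>) = (\<Sum>x\<in>K \<omega>. pmf D x * f x) / m \<omega>"
      unfolding m_def using KD(1,2)[OF w] finK[OF w] D by (intro cond_expect_eq_sum) auto
    then show "pmf D \<omega> * (cond_expect D f (K \<omega>) * h \<omega>)
        = (\<Sum>x\<in>K \<omega>. pmf D \<omega> * (pmf D x * f x * h \<omega> / m \<omega>))"
      by (simp add: sum_distrib_left sum_distrib_right sum_divide_distrib)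
  qed
  also have "\<dots> = (\<Sum>\<omega>\<in>\<Omega>. \<Sum>x\<in>\<Omega>. if x \<in> K \<omega> then pmf D \<omega> * (pmf D x * f x * h \<omega> / m \<omega>) else 0)"
    by (rule sum.cong[OF refl]) (simp add: restr)
  \<comment> \<open>Within a cell \<open>m\<close> and \<open>h\<close> can be read off at
    \<open>x\<close> instead of \<open>\<omega>\<close>. Then only the factor
    \<open>pmf D \<omega>\<close> depends on \<open>\<omega>\<close>, and it sums to
    \<open>m x\<close> over \<open>K x\<close>.\<close>
  also have "\<dots> = (\<Sum>\<omega>\<in>\<Omega>. \<Sum>x\<in>\<Omega>. if \<omega> \<in> K x then pmf D \<omega> * (pmf D x * f x * h x / m x) else 0)"
  proof (intro sum.cong refl)
    fix \<omega> x assume w: "\<omega> \<in> \<Omega>" and x: "x \<in> \<Omega>"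
    have "m x = m \<omega>" "h x = h \<omega>" if "x \<in> K \<omega>"
      using KD(3)[OF w that] h[OF w that] by (auto simp: m_def)
    then show "(if x \<in> K \<omega> then pmf D \<omega> * (pmf D x * f x * h \<omega> / m \<omega>) else 0)
        = (if \<omega> \<in> K x then pmf D \<omega> * (pmf D x * f x * h x / m x) else 0)"
      using sym[OF w x] by auto
  qed
  also have "\<dots> = (\<Sum>x\<in>\<Omega>. \<Sum>\<omega>\<in>K x. pmf D \<omega> * (pmf D x * f x * h x / m x))"
    by (subst sum.swap, rule sum.cong[OF refl]) (rule restr)
  also have "\<dots> = (\<Sum>x\<in>\<Omega>. m x * (pmf D x * f x * h x / m x))"
    by (simp only: m_def sum_distrib_right)
  also have "\<dots> = (\<Sum>x\<in>\<Omega>. pmf D x * (f x * h x))"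
  proof (rule sum.cong[OF refl])
    fix x assume "x \<in> \<Omega>"
    from mpos[OF this] show "m x * (pmf D x * f x * h x / m x) = pmf D x * (f x * h x)"
      by simp
  qed
  finally show ?thesis .
qed

text \<open>The cross term vanishes: with \<open>F\<close> and \<open>G\<close> the expectations
  under \<open>K\<close> and \<open>L\<close>, the function \<open>F - c\<close> is constant on the
  cells of both maps, so \<open>F\<close> and \<open>G\<close> have the same inner product with it
  as \<open>f\<close>. The link between \<open>K\<close> and \<open>L\<close> is \<open>meas\<close>
  rather than refinement, because a message reveals the sender's expectation and not the sender's
  cell.\<close>

lemma cond_expect_pythagoras:
  assumes fin: "finite \<Omega>" and D: "set_pmf D = \<Omega>"
    and K: "information_map \<Omega> K" and L: "information_map \<Omega> L"
    and meas: "\<And>\<omega> \<omega>'. \<omega> \<in> \<Omega> \<Longrightarrow> \<omega>' \<in> L \<omega> \<Longrightarrow> cond_expect D f (K \<omega>') = cond_expect D f (K \<omega>)"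
  shows "(\<Sum>\<omega>\<in>\<Omega>. pmf D \<omega> * (cond_expect D f (L \<omega>) - c)\<^sup>2) =
    (\<Sum>\<omega>\<in>\<Omega>. pmf D \<omega> * (cond_expect D f (K \<omega>) - c)\<^sup>2) +
    (\<Sum>\<omega>\<in>\<Omega>. pmf D \<omega> * (cond_expect D f (L \<omega>) - cond_expect D f (K \<omega>))\<^sup>2)"
proof -
  define F where "F \<omega> = cond_expect D f (K \<omega>)" for \<omega>
  define G where "G \<omega> = cond_expect D f (L \<omega>)" for \<omega>
  have "(\<Sum>\<omega>\<in>\<Omega>. pmf D \<omega> * (G \<omega> * (F \<omega> - c))) = (\<Sum>\<omega>\<in>\<Omega>. pmf D \<omega> * (f \<omega> * (F \<omega> - c)))"
    unfolding F_def G_def by (rule sum_cond_expect_mult[OF fin D L]) (simp add: meas)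
  moreover have "(\<Sum>\<omega>\<in>\<Omega>. pmf D \<omega> * (F \<omega> * (F \<omega> - c))) = (\<Sum>\<omega>\<in>\<Omega>. pmf D \<omega> * (f \<omega> * (F \<omega> - c)))"
    unfolding F_def by (rule sum_cond_expect_mult[OF fin D K]) (simp add: information_mapD(3)[OF K])
  \<comment> \<open>The cross term \<open>2 * (G - F) * (F - c)\<close> is split so that the two
    identities above cancel its halves.\<close>
  moreover have "(\<Sum>\<omega>\<in>\<Omega>. pmf D \<omega> * (G \<omega> - c)\<^sup>2) =
      (\<Sum>\<omega>\<in>\<Omega>. pmf D \<omega> * (F \<omega> - c)\<^sup>2 + pmf D \<omega> * (G \<omega> - F \<omega>)\<^sup>2
        + 2 * (pmf D \<omega> * (G \<omega> * (F \<omega> - c))) - 2 * (pmf D \<omega> * (F \<omega> * (F \<omega> - c))))"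
    by (intro sum.cong refl) (simp add: power2_eq_square algebra_simps)
  ultimately show ?thesis
    unfolding F_def[symmetric] G_def[symmetric]
    by (simp add: sum.distrib sum_subtractf sum_distrib_left[symmetric])
qed

section \<open>Energy increment along the protocol\<close>

text \<open>Markov's inequality for the square of \<open>X\<close>, in contrapositive form so that
  the strict inequality survives.\<close>

lemma second_moment_gt_of_prob_gt:
  assumes fin: "finite (set_pmf D)" and "\<epsilon> > 0"
    and prob: "measure_pmf.prob D {\<omega>. \<bar>X \<omega>\<bar> > \<epsilon>} > \<delta>"
  shows "(\<Sum>\<omega>\<in>set_pmf D. pmf D \<omega> * (X \<omega>)\<^sup>2) > \<delta> * \<epsilon>\<^sup>2"
proof -
  let ?A = "{\<omega> \<in> set_pmf D. \<bar>X \<omega>\<bar> > \<epsilon>}"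
  have "measure_pmf.prob D {\<omega>. \<bar>X \<omega>\<bar> > \<epsilon>} = measure_pmf.prob D ?A"
    by (subst measure_Int_set_pmf[symmetric]) (simp add: Int_def conj_commute)
  also have "\<dots> = (\<Sum>\<omega>\<in>?A. pmf D \<omega>)"
    using fin by (simp add: measure_measure_pmf_finite)
  finally have "\<delta> * \<epsilon>\<^sup>2 < (\<Sum>\<omega>\<in>?A. pmf D \<omega>) * \<epsilon>\<^sup>2"
    using prob \<open>\<epsilon> > 0\<close> by simp
  also have "\<dots> \<le> (\<Sum>\<omega>\<in>?A. pmf D \<omega> * (X \<omega>)\<^sup>2)"
    unfolding sum_distrib_right
  proof (intro sum_mono mult_left_mono)
    fix \<omega> assume "\<omega> \<in> ?A"
    then show "\<epsilon>\<^sup>2 \<le> (X \<omega>)\<^sup>2"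
      using \<open>\<epsilon> > 0\<close> by (intro abs_le_square_iff[THEN iffD1]) auto
  qed simp
  also have "\<dots> \<le> (\<Sum>\<omega>\<in>set_pmf D. pmf D \<omega> * (X \<omega>)\<^sup>2)"
    using fin by (intro sum_mono2) auto
  finally show ?thesis .
qed

theorem theorem5:
  fixes \<Omega> :: "'w set" and D :: "'w pmf" and P :: "agent \<Rightarrow> 'w set set"
    and f :: "'w \<Rightarrow> real" and \<epsilon> \<delta> :: real
  assumes "finite \<Omega>"
    and "set_pmf D = \<Omega>"
    and "\<And>i. partition_on \<Omega> (P i)"
    and "\<And>\<omega>. \<omega> \<in> \<Omega> \<Longrightarrow> f \<omega> \<in> {0..1}"
    and "\<epsilon> > 0" and "\<delta> > 0"
  shows "\<exists>t::nat. real t \<le> 1 / (\<delta> * \<epsilon>\<^sup>2) \<and> agree_after D f P \<epsilon> \<delta> t"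
proof (rule ccontr)
  assume "\<not> ?thesis"
  then have no_agree: "\<not> agree_after D f P \<epsilon> \<delta> t" if "real t \<le> 1 / (\<delta> * \<epsilon>\<^sup>2)" for t
    using that by blast
  define x where "x = \<delta> * \<epsilon>\<^sup>2"
  have x: "x > 0" using assms by (simp add: x_def)
  let ?K = "knowledge D f P"
  let ?E = "expect D f P"
  have K: "information_map \<Omega> (?K t i)" for t i
    by (rule information_map_knowledge) (rule assms(3))
  have E01: "?E i t \<omega> \<in> {0..1}" if "\<omega> \<in> \<Omega>" for i t \<omega>
  proof -
    note KD = information_mapD(1,2)[OF K that, of t i]
    show ?thesis
      unfolding expect_def
    proof (rule cond_expect_mem_Icc)
      show "finite (?K t i \<omega>)" using KD(2) assms(1) by (rule finite_subset)
      show "?K t i \<omega> \<subseteq> set_pmf D" using KD(2) assms(2) by blast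
      show "?K t i \<omega> \<noteq> {}" using KD(1) by blast
      show "f x \<in> {0..1}" if "x \<in> ?K t i \<omega>" for x
        using KD(2) that by (intro assms(4)) blast
    qed
  qed
  define M where "M g = (\<Sum>\<omega>\<in>\<Omega>. pmf D \<omega> * (g \<omega>)\<^sup>2)" for g :: "'w \<Rightarrow> real"
  have M_le: "M g \<le> b\<^sup>2" if "\<And>\<omega>. \<omega> \<in> \<Omega> \<Longrightarrow> \<bar>g \<omega>\<bar> \<le> \<bar>b\<bar>" for g b
  proof -
    have "M g \<le> (\<Sum>\<omega>\<in>\<Omega>. pmf D \<omega> * b\<^sup>2)"
      unfolding M_def using that
      by (intro sum_mono mult_left_mono) (auto simp: abs_le_square_iff)
    also have "\<dots> = b\<^sup>2"
      using sum_pmf_eq_1[of \<Omega> D] assms(1,2) by (simp add: sum_distrib_right[symmetric])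
    finally show ?thesis .
  qed
  have disagree: "x < M (\<lambda>\<omega>. ?E Alice t \<omega> - ?E Bob t \<omega>)" if "real t \<le> 1 / x" for t
    using second_moment_gt_of_prob_gt[of D \<epsilon> \<delta> "\<lambda>\<omega>. ?E Alice t \<omega> - ?E Bob t \<omega>"]
      no_agree[of t] that assms(1,2,5)
    by (simp add: x_def M_def agree_after_def)
  \<comment> \<open>The potential follows the agent about to speak: Alice at time 0, and afterwards
    the receiver of message \<open>t\<close>.\<close>
  define a where "a t = M (\<lambda>\<omega>. ?E (sender (Suc t)) t \<omega> - 1/2)" for t
  have a_nonneg: "a t \<ge> 0" for t
    by (auto simp: a_def M_def intro!: sum_nonneg)
  have a_le: "a t \<le> 1/4" for t
  proof -
    have "a t \<le> (1/2)\<^sup>2"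
      unfolding a_def
    proof (rule M_le)
      fix \<omega> assume "\<omega> \<in> \<Omega>"
      from E01[OF this, of "sender (Suc t)" t]
      show "\<bar>?E (sender (Suc t)) t \<omega> - 1/2\<bar> \<le> \<bar>1/2\<bar>"
        unfolding atLeastAtMost_iff by linarith
    qed
    then show ?thesis by (simp add: power2_eq_square)
  qed
  have step: "a (Suc t) > a t + x" if "real (Suc t) \<le> 1 / x" for t
  proof -
    define i where "i = sender (Suc t)"
    define j where "j = sender (Suc (Suc t))"
    have ij: "i \<noteq> j" by (simp add: i_def j_def sender_def)
    have same: "?E i (Suc t) = ?E i t"
      by (simp add: expect_def[abs_def] i_def)
    \<comment> \<open>Message \<open>Suc t\<close> goes from \<open>i\<close> to \<open>j\<close>.
      Pythagoras compares the cells of \<open>i\<close> before it with those of \<open>j\<close>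
      after it; \<open>meas\<close> holds because \<open>j\<close> has just intersected with the
      level set of the announced value. By \<open>same\<close>, the increment is the disagreement
      after the message.\<close>
    have "a (Suc t) = a t + M (\<lambda>\<omega>. ?E j (Suc t) \<omega> - ?E i t \<omega>)"
      unfolding a_def M_def expect_def i_def[symmetric] j_def[symmetric]
      by (rule cond_expect_pythagoras[OF assms(1,2) K K])
        (use ij in \<open>simp add: i_def[symmetric]\<close>)
    moreover have "M (\<lambda>\<omega>. ?E j (Suc t) \<omega> - ?E i (Suc t) \<omega>)
        = M (\<lambda>\<omega>. ?E Alice (Suc t) \<omega> - ?E Bob (Suc t) \<omega>)"
      using ij by (cases i; cases j) (auto simp: M_def power2_commute)
    ultimately show ?thesis using disagree[OF that] same by simp
  qed
  have grow: "a t \<ge> real t * x" if "real t \<le> 1 / x" for t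
    using that
  proof (induction t)
    case 0
    then show ?case using a_nonneg by simp
  next
    case (Suc t)
    then show ?case using step[of t] by (simp add: algebra_simps)
  qed
  \<comment> \<open>Disagreement before any message forces \<open>x < 1\<close>, so at least one
    message fits within the bound.\<close>
  have "x < M (\<lambda>\<omega>. ?E Alice 0 \<omega> - ?E Bob 0 \<omega>)"
    using disagree[of 0] x by simp
  also have "\<dots> \<le> 1\<^sup>2"
  proof (rule M_le)
    fix \<omega> assume "\<omega> \<in> \<Omega>"
    from E01[OF this, of Alice 0] E01[OF this, of Bob 0]
    show "\<bar>?E Alice 0 \<omega> - ?E Bob 0 \<omega>\<bar> \<le> \<bar>1\<bar>"
      by (simp add: abs_le_iff)
  qed
  finally have "1 / x > 1" using x by simp
  \<comment> \<open>\<open>T\<close> is the largest admissible number of messages. From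
    \<open>T \<ge> 1\<close> follows \<open>1 / x < T + 1 \<le> 2 * T\<close>, hence
    \<open>T * x > 1/2\<close>, although \<open>T * x \<le> a T \<le> 1/4\<close>.\<close>
  define T where "T = nat \<lfloor>1 / x\<rfloor>"
  have "\<lfloor>1 / x\<rfloor> \<ge> 1"
    using \<open>1 / x > 1\<close> by linarith
  then have T: "real T \<le> 1 / x" "1 / x < real T + 1" "real T \<ge> 1"
    using \<open>1 / x > 1\<close> unfolding T_def by linarith+
  then have "1 / x < 2 * real T" by linarith
  then have "2 * (real T * x) > 1"
    using x by (simp add: pos_divide_less_eq)
  then show False
    using grow[OF T(1)] a_le[of T] by simp
qed

end
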